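(* Let $A=(A,\cdot,\circ)$ be a bi-skew brace, let $A_{\leftrightarrow}=(A,\circ,\cdot)$ be the skew brace obtained by swapping the two operations, and let $n$ be a nonnegative integer. Then $A$ is soluble of class $n$ if and only if $A_{\leftrightarrow}$ is soluble of class $n$.
   Context: A skew brace (meaning skew left brace) is a set $A$ with two group structures $(A,\cdot)$ (the additive group) and $(A,\circ)$ (the multiplicative group) such that $a\circ(b\cdot c)=(a\circ b)\cdot a^{-1}\cdot(a\circ c)$ for all $a,b,c\in A$, where $a^{-1}$ is the inverse of $a$ in $(A,\cdot)$. The two groups have the same neutral element, denoted $1$. A bi-skew brace is a skew brace $(A,\cdot,\circ)$ such that $(A,\circ,\cdot)$ is also a skew brace. For a skew brace $(A,\cdot,\circ)$ and $a,b\in A$ put $a*b=a^{-1}\cdot(a\circ b)\cdot b^{-1}$. For subsets $X,Y\subseteq A$, $X*Y$ is the subgroup of the additive group $(A,\cdot)$ generated by $\{x*y\mid x\in X,\ y\in Y\}$. Set $A_1=A$ and $A_m=A_{m-1}*A_{m-1}$ for $m\ge 2$. The skew brace $A$ is soluble if $A_m=\{1\}$ for some $m\ge1$; if $m$ is minimal with this property, $m-1$ is called the solubility class of $A$. For $A_{\leftrightarrow}$ all these notions are applied to the skew brace $(A,\circ,\cdot)$, whose additive group is $(A,\circ)$. *)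

theory Defs
  imports "HOL-Algebra.Generated_Groups"
begin

text \<open>
  A skew left brace is given by two group structures on one carrier: \<open>G\<close> is the additive group
  (operation \<open>\<cdot>\<close>, possibly nonabelian) and \<open>H\<close> the multiplicative group (operation \<open>\<circ>\<close>).
  That the two neutral elements coincide is a consequence of the axioms.
\<close>

locale skew_brace = add: group G + mult: group H
  for G :: "('a, 'b) monoid_scheme" and H :: "('a, 'c) monoid_scheme" +
  assumes carrier_eq: "carrier H = carrier G"
    and brace_law: "\<lbrakk>a \<in> carrier G; b \<in> carrier G; c \<in> carrier G\<rbrakk> \<Longrightarrow>
      a \<otimes>\<^bsub>H\<^esub> (b \<otimes>\<^bsub>G\<^esub> c) = (a \<otimes>\<^bsub>H\<^esub> b) \<otimes>\<^bsub>G\<^esub> inv\<^bsub>G\<^esub> a \<otimes>\<^bsub>G\<^esub> (a \<otimes>\<^bsub>H\<^esub> c)"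

locale bi_skew_brace = skew_brace G H + swap: skew_brace H G
  for G :: "('a, 'b) monoid_scheme" and H :: "('a, 'c) monoid_scheme"

definition brace_star ::
    "('a, 'b) monoid_scheme \<Rightarrow> ('a, 'c) monoid_scheme \<Rightarrow> 'a \<Rightarrow> 'a \<Rightarrow> 'a" where
  "brace_star G H a b = inv\<^bsub>G\<^esub> a \<otimes>\<^bsub>G\<^esub> (a \<otimes>\<^bsub>H\<^esub> b) \<otimes>\<^bsub>G\<^esub> inv\<^bsub>G\<^esub> b"

definition brace_star_set ::
    "('a, 'b) monoid_scheme \<Rightarrow> ('a, 'c) monoid_scheme \<Rightarrow> 'a set \<Rightarrow> 'a set \<Rightarrow> 'a set" where
  "brace_star_set G H X Y = generate G {brace_star G H x y | x y. x \<in> X \<and> y \<in> Y}"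

text \<open>
  The index is shifted by one: \<open>brace_derived G H k\<close> is the term \<open>A\<^sub>k\<^sub>+\<^sub>1\<close> of the series starting
  with \<open>A\<^sub>1 = A\<close>. So the solubility class, which is \<open>m - 1\<close> for the least \<open>m \<ge> 1\<close> with
  \<open>A\<^sub>m = {1}\<close>, is the least \<open>k\<close> for which \<open>brace_derived G H k\<close> is trivial.
\<close>

primrec brace_derived ::
    "('a, 'b) monoid_scheme \<Rightarrow> ('a, 'c) monoid_scheme \<Rightarrow> nat \<Rightarrow> 'a set" where
  "brace_derived G H 0 = carrier G"
| "brace_derived G H (Suc k) = brace_star_set G H (brace_derived G H k) (brace_derived G H k)"

definition brace_soluble :: "('a, 'b) monoid_scheme \<Rightarrow> ('a, 'c) monoid_scheme \<Rightarrow> bool" where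
  "brace_soluble G H \<longleftrightarrow> (\<exists>k. brace_derived G H k = {\<one>\<^bsub>G\<^esub>})"

text \<open>Only meaningful for soluble skew braces.\<close>

definition solubility_class :: "('a, 'b) monoid_scheme \<Rightarrow> ('a, 'c) monoid_scheme \<Rightarrow> nat" where
  "solubility_class G H = (LEAST k. brace_derived G H k = {\<one>\<^bsub>G\<^esub>})"

definition soluble_of_class ::
    "('a, 'b) monoid_scheme \<Rightarrow> ('a, 'c) monoid_scheme \<Rightarrow> nat \<Rightarrow> bool" where
  "soluble_of_class G H n \<longleftrightarrow> brace_soluble G H \<and> solubility_class G H = n"

end

theory Submission imports Defs begin

text \<open>
  The two series agree term by term: \<open>brace_derived G H k = brace_derived H G k\<close> for every \<open>k\<close>,
  so the two notions of solubility, and the two classes, coincide.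

  Write \<open>\<lambda>\<^sub>a(b) = a\<^sup>-\<^sup>1 \<cdot> (a \<circ> b)\<close>, so that \<open>a * b = \<lambda>\<^sub>a(b) \<cdot> b\<^sup>-\<^sup>1\<close>. In a skew brace \<open>\<lambda>\<close> is an
  action of \<open>(A,\<circ>)\<close> on \<open>(A,\<cdot>)\<close> by automorphisms. For the swapped brace the corresponding map
  is \<open>\<lambda>\<^sub>a\<^sup>-\<^sup>1\<close>; hence in a bi-skew brace each \<open>\<lambda>\<^sub>a\<close> is an automorphism of both groups,
  which forces \<open>\<lambda>\<close> to satisfy \<open>\<lambda>\<^bsub>\<lambda>\<^sub>a(b)\<^esub> = \<lambda>\<^sub>a \<lambda>\<^sub>b \<lambda>\<^sub>a\<^sup>-\<^sup>1\<close>. With bars for inverses in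
  \<open>(A,\<circ>)\<close>, a short computation turns this into the identity

    \<open>\<lambda>\<^sub>a(b) \<circ> b\<^sup>\<bar> = (a * b) \<cdot> (d * b)\<^sup>-\<^sup>1\<close>, where \<open>d = a \<circ> b \<circ> a\<^sup>\<bar> \<circ> b\<^sup>\<bar>\<close>.

  The left-hand sides are the generators of the next term of the swapped series. Let \<open>B\<close> be a
  subgroup of both groups. The identity shows that the additive group \<open>B * B\<close> contains every
  swapped star product of elements of \<open>B\<close>. Moreover \<open>B * B\<close> is invariant under all
  \<open>\<lambda>\<^sub>b\<close> with \<open>b \<in> B\<close>, hence is a subgroup of \<open>(A,\<circ>)\<close> too, and so it contains the subgroup of
  \<open>(A,\<circ>)\<close> that those products generate. Exchanging the two operations gives the reverse
  inclusion, and induction on \<open>k\<close> finishes the argument.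
\<close>

section \<open>The lambda action of a skew brace\<close>

context skew_brace
begin

definition lam :: "'a \<Rightarrow> 'a \<Rightarrow> 'a" where
  "lam a b = inv\<^bsub>G\<^esub> a \<otimes>\<^bsub>G\<^esub> (a \<otimes>\<^bsub>H\<^esub> b)"

lemma mult_closed [simp]:
  "\<lbrakk>a \<in> carrier G; b \<in> carrier G\<rbrakk> \<Longrightarrow> a \<otimes>\<^bsub>H\<^esub> b \<in> carrier G"
  using mult.m_closed carrier_eq by simp

lemma mult_inv_closed [simp]: "a \<in> carrier G \<Longrightarrow> inv\<^bsub>H\<^esub> a \<in> carrier G"
  using mult.inv_closed carrier_eq by simp

text \<open>The brace law for \<open>u \<circ> (1 \<cdot> 1)\<close>, where \<open>u\<close> is the multiplicative and \<open>1\<close> the additive unit,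
  reads \<open>1 = u\<^sup>-\<^sup>1\<close>.\<close>

lemma one_eq: "\<one>\<^bsub>H\<^esub> = \<one>\<^bsub>G\<^esub>"
proof -
  let ?u = "\<one>\<^bsub>H\<^esub>" and ?e = "\<one>\<^bsub>G\<^esub>"
  have u: "?u \<in> carrier G"
    using carrier_eq mult.one_closed by simp
  have e: "?u \<otimes>\<^bsub>H\<^esub> ?e = ?e"
    using carrier_eq by simp
  have "?e = ?e \<otimes>\<^bsub>G\<^esub> inv\<^bsub>G\<^esub> ?u \<otimes>\<^bsub>G\<^esub> ?e"
    using brace_law[of ?u ?e ?e] u e by simp
  then have "inv\<^bsub>G\<^esub> ?u = ?e"
    using u by simp
  then show ?thesis
    using u by (metis add.inv_inv add.inv_one)
qed

lemma lam_closed [simp]: "\<lbrakk>a \<in> carrier G; b \<in> carrier G\<rbrakk> \<Longrightarrow> lam a b \<in> carrier G"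
  by (simp add: lam_def)

lemma mult_eq_add_lam:
  "\<lbrakk>a \<in> carrier G; b \<in> carrier G\<rbrakk> \<Longrightarrow> a \<otimes>\<^bsub>H\<^esub> b = a \<otimes>\<^bsub>G\<^esub> lam a b"
  by (simp add: lam_def add.m_assoc[symmetric])

lemma brace_star_eq_lam: "brace_star G H a b = lam a b \<otimes>\<^bsub>G\<^esub> inv\<^bsub>G\<^esub> b"
  by (simp add: brace_star_def lam_def)

lemma lam_add:
  assumes "a \<in> carrier G" "b \<in> carrier G" "c \<in> carrier G"
  shows "lam a (b \<otimes>\<^bsub>G\<^esub> c) = lam a b \<otimes>\<^bsub>G\<^esub> lam a c"
  using assms by (simp add: lam_def brace_law add.m_assoc)

lemma lam_hom: "a \<in> carrier G \<Longrightarrow> group_hom G G (lam a)"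
  by (unfold_locales) (auto simp: hom_def lam_add)

lemma lam_inv:
  "\<lbrakk>a \<in> carrier G; b \<in> carrier G\<rbrakk> \<Longrightarrow> lam a (inv\<^bsub>G\<^esub> b) = inv\<^bsub>G\<^esub> (lam a b)"
  by (rule group_hom.hom_inv[OF lam_hom])

text \<open>Both sides are additively \<open>(a \<circ> b)\<^sup>-\<^sup>1 \<cdot> (a \<circ> b \<circ> c)\<close>.\<close>

lemma lam_mult:
  assumes "a \<in> carrier G" "b \<in> carrier G" "c \<in> carrier G"
  shows "lam (a \<otimes>\<^bsub>H\<^esub> b) c = lam a (lam b c)"
proof -
  have "(a \<otimes>\<^bsub>H\<^esub> b) \<otimes>\<^bsub>G\<^esub> lam (a \<otimes>\<^bsub>H\<^esub> b) c = a \<otimes>\<^bsub>H\<^esub> b \<otimes>\<^bsub>H\<^esub> c"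
    using assms mult_eq_add_lam[of "a \<otimes>\<^bsub>H\<^esub> b" c] by simp
  also have "\<dots> = a \<otimes>\<^bsub>H\<^esub> (b \<otimes>\<^bsub>H\<^esub> c)"
    using assms carrier_eq by (simp add: mult.m_assoc)
  also have "\<dots> = a \<otimes>\<^bsub>G\<^esub> lam a (b \<otimes>\<^bsub>G\<^esub> lam b c)"
    using assms by (simp add: mult_eq_add_lam)
  also have "\<dots> = (a \<otimes>\<^bsub>H\<^esub> b) \<otimes>\<^bsub>G\<^esub> lam a (lam b c)"
    using assms by (simp add: lam_add mult_eq_add_lam add.m_assoc)
  finally show ?thesis
    using assms by simp
qed

lemma lam_one: "b \<in> carrier G \<Longrightarrow> lam \<one>\<^bsub>G\<^esub> b = b"
  using carrier_eq mult.l_one[of b] by (simp add: lam_def one_eq)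

lemma lam_lam_inv:
  assumes "a \<in> carrier G" "b \<in> carrier G"
  shows "lam a (lam (inv\<^bsub>H\<^esub> a) b) = b" "lam (inv\<^bsub>H\<^esub> a) (lam a b) = b"
  using assms carrier_eq by (simp_all flip: lam_mult add: one_eq lam_one)

lemma mult_inv_eq_lam:
  assumes "a \<in> carrier G"
  shows "inv\<^bsub>H\<^esub> a = lam (inv\<^bsub>H\<^esub> a) (inv\<^bsub>G\<^esub> a)"
proof -
  have "a \<otimes>\<^bsub>G\<^esub> lam a (inv\<^bsub>H\<^esub> a) = \<one>\<^bsub>G\<^esub>"
    using assms carrier_eq mult.r_inv[of a] by (simp flip: mult_eq_add_lam add: one_eq)
  then have "lam a (inv\<^bsub>H\<^esub> a) = inv\<^bsub>G\<^esub> a"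
    using assms by (metis add.inv_equality add.inv_inv lam_closed mult_inv_closed)
  then show ?thesis
    using assms lam_lam_inv(2)[of a "inv\<^bsub>H\<^esub> a"] by simp
qed

text \<open>
  For an additive subgroup the operation \<open>x \<circ> y = x \<cdot> \<lambda>\<^sub>x(y)\<close> stays inside as soon as \<open>\<lambda>\<close> does.
\<close>

lemma lam_invariant_subgroup:
  assumes S: "subgroup S G"
    and inv: "\<And>x y. \<lbrakk>x \<in> S; y \<in> S\<rbrakk> \<Longrightarrow> lam x y \<in> S"
    and inv': "\<And>x y. \<lbrakk>x \<in> S; y \<in> S\<rbrakk> \<Longrightarrow> lam (inv\<^bsub>H\<^esub> x) y \<in> S"
  shows "subgroup S H"
proof
  note sub = subgroup.mem_carrier[OF S]
  show "S \<subseteq> carrier H"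
    using sub carrier_eq by auto
  show "\<one>\<^bsub>H\<^esub> \<in> S"
    using S by (simp add: one_eq subgroup.one_closed)
  show "x \<otimes>\<^bsub>H\<^esub> y \<in> S" if "x \<in> S" "y \<in> S" for x y
    using that sub inv by (simp add: mult_eq_add_lam subgroup.m_closed[OF S])
  show "inv\<^bsub>H\<^esub> x \<in> S" if "x \<in> S" for x
    using that sub inv' mult_inv_eq_lam[of x] subgroup.m_inv_closed[OF S] by metis
qed

text \<open>
  Since \<open>\<lambda>\<close> is an action, \<open>\<lambda>\<^sub>c\<close> moves a star product to a star product, with \<open>c\<close> acting on the
  first factor by conjugation in \<open>(A,\<circ>)\<close>.
\<close>

lemma lam_brace_star:
  assumes "a \<in> carrier G" "b \<in> carrier G" "c \<in> carrier G"
  shows "lam c (brace_star G H a b) = brace_star G H (c \<otimes>\<^bsub>H\<^esub> a \<otimes>\<^bsub>H\<^esub> inv\<^bsub>H\<^esub> c) (lam c b)"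
  using assms by (simp add: brace_star_eq_lam lam_add lam_inv lam_mult lam_lam_inv)

context
  fixes B
  assumes subG: "subgroup B G" and subH: "subgroup B H"
begin

lemma brace_star_gens_subset:
  "{brace_star G H x y | x y. x \<in> B \<and> y \<in> B} \<subseteq> B"
  using subgroup.m_closed[OF subG] subgroup.m_inv_closed[OF subG] subgroup.m_closed[OF subH]
  by (auto simp: brace_star_def)

lemma brace_star_set_subset: "brace_star_set G H B B \<subseteq> B"
  unfolding brace_star_set_def
  by (rule add.generate_subgroup_incl[OF brace_star_gens_subset subG])

lemma brace_star_set_add_subgroup: "subgroup (brace_star_set G H B B) G"
  unfolding brace_star_set_def
  using brace_star_gens_subset subgroup.subset[OF subG]
  by (intro add.generate_is_subgroup) blast

lemma brace_star_in_brace_star_set: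
  "\<lbrakk>x \<in> B; y \<in> B\<rbrakk> \<Longrightarrow> brace_star G H x y \<in> brace_star_set G H B B"
  unfolding brace_star_set_def by (intro generate.incl) blast

lemma lam_brace_star_set:
  assumes c: "c \<in> B" and y: "y \<in> brace_star_set G H B B"
  shows "lam c y \<in> brace_star_set G H B B"
proof -
  let ?gens = "{brace_star G H x y | x y. x \<in> B \<and> y \<in> B}"
  note carr = subgroup.mem_carrier[OF subG]
  have hom: "group_hom G G (lam c)"
    using c carr by (intro lam_hom)
  have lam_B: "lam c b \<in> B" if "b \<in> B" for b
    using c that unfolding lam_def
    by (simp add: subG subH subgroup.m_closed subgroup.m_inv_closed)
  have "lam c ` ?gens \<subseteq> ?gens"
  proof clarsimp
    fix a b assume ab: "a \<in> B" "b \<in> B"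
    have "c \<otimes>\<^bsub>H\<^esub> a \<otimes>\<^bsub>H\<^esub> inv\<^bsub>H\<^esub> c \<in> B"
      using c ab by (simp add: subH subgroup.m_closed subgroup.m_inv_closed)
    then show "\<exists>x y. lam c (brace_star G H a b) = brace_star G H x y \<and> x \<in> B \<and> y \<in> B"
      using lam_brace_star[of a b c] lam_B ab c carr by blast
  qed
  then have "generate G (lam c ` ?gens) \<subseteq> generate G ?gens"
    by (rule add.mono_generate)
  moreover have "lam c ` generate G ?gens = generate G (lam c ` ?gens)"
    using brace_star_gens_subset subgroup.subset[OF subG]
    by (intro group_hom.generate_img[OF hom, symmetric]) blast
  ultimately show ?thesis
    using y unfolding brace_star_set_def by blast
qed

lemma brace_star_set_mult_subgroup: "subgroup (brace_star_set G H B B) H"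
  using brace_star_set_subset subgroup.m_inv_closed[OF subH]
  by (intro lam_invariant_subgroup brace_star_set_add_subgroup lam_brace_star_set) blast+

end

end

section \<open>The derived series of a bi-skew brace\<close>

context bi_skew_brace
begin

lemma bi_skew_brace_swap: "bi_skew_brace H G"
  by unfold_locales

text \<open>Both maps invert \<open>\<lambda>\<^sub>a\<close>, because \<open>a \<cdot> b = a \<circ> \<lambda>\<^sub>a\<^sup>-\<^sup>1(b)\<close>.\<close>

lemma swap_lam_eq:
  assumes "a \<in> carrier G" "b \<in> carrier G"
  shows "swap.lam a b = lam (inv\<^bsub>H\<^esub> a) b"
proof -
  have "a \<otimes>\<^bsub>H\<^esub> lam (inv\<^bsub>H\<^esub> a) b = a \<otimes>\<^bsub>G\<^esub> b"
    using assms by (simp add: mult_eq_add_lam lam_lam_inv)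
  also have "\<dots> = a \<otimes>\<^bsub>H\<^esub> swap.lam a b"
    using assms carrier_eq by (intro swap.mult_eq_add_lam) auto
  finally show ?thesis
    using assms carrier_eq swap.lam_closed[of a b] by simp
qed

text \<open>
  The map \<open>\<lambda>\<^sub>a\<close> is the swapped lambda map of the element inverse to \<open>a\<close> in \<open>(A,\<circ>)\<close>, so it is an
  endomorphism of \<open>(A,\<circ>)\<close> as well.
\<close>

lemma lam_mult_hom:
  assumes "a \<in> carrier G" "b \<in> carrier G" "c \<in> carrier G"
  shows "lam a (b \<otimes>\<^bsub>H\<^esub> c) = lam a b \<otimes>\<^bsub>H\<^esub> lam a c"
proof -
  have *: "lam a x = swap.lam (inv\<^bsub>H\<^esub> a) x" if "x \<in> carrier G" for x
    using assms(1) that carrier_eq by (simp add: swap_lam_eq)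
  show ?thesis
    using assms carrier_eq swap.lam_add[of "inv\<^bsub>H\<^esub> a" b c] by (simp add: *)
qed

text \<open>
  Apply \<open>\<lambda>\<^sub>a\<close> to \<open>b \<circ> c = b \<cdot> \<lambda>\<^sub>b(c)\<close>, once as a homomorphism of \<open>(A,\<circ>)\<close> and once as a
  homomorphism of \<open>(A,\<cdot>)\<close>.
\<close>

lemma lam_lam_conjugate:
  assumes "a \<in> carrier G" "b \<in> carrier G" "c \<in> carrier G"
  shows "lam (lam a b) (lam a c) = lam a (lam b c)"
proof -
  have "lam a b \<otimes>\<^bsub>G\<^esub> lam (lam a b) (lam a c) = lam a (b \<otimes>\<^bsub>H\<^esub> c)"
    using assms by (simp add: lam_mult_hom flip: mult_eq_add_lam)
  also have "\<dots> = lam a b \<otimes>\<^bsub>G\<^esub> lam a (lam b c)"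
    using assms by (simp add: mult_eq_add_lam lam_add)
  finally show ?thesis
    using assms by simp
qed

text \<open>
  Put \<open>x = \<lambda>\<^sub>a(b)\<close>. Then \<open>x \<circ> b\<^sup>\<bar> = x \<cdot> \<lambda>\<^sub>x(b\<^sup>\<bar>)\<close>, and \<open>\<lambda>\<^sub>x = \<lambda>\<^sub>a \<lambda>\<^sub>b \<lambda>\<^sub>a\<^sup>-\<^sup>1\<close> together with
  \<open>b\<^sup>\<bar> = \<lambda>\<^sub>b\<^sup>-\<^sup>1(b\<^sup>-\<^sup>1)\<close> makes the second factor \<open>\<lambda>\<^sub>d(b\<^sup>-\<^sup>1)\<close> for the commutator \<open>d\<close>.
\<close>

lemma lam_mult_inv_eq_stars:
  assumes a: "a \<in> carrier G" and b: "b \<in> carrier G"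
  defines "d \<equiv> a \<otimes>\<^bsub>H\<^esub> b \<otimes>\<^bsub>H\<^esub> inv\<^bsub>H\<^esub> a \<otimes>\<^bsub>H\<^esub> inv\<^bsub>H\<^esub> b"
  shows "lam a b \<otimes>\<^bsub>H\<^esub> inv\<^bsub>H\<^esub> b = brace_star G H a b \<otimes>\<^bsub>G\<^esub> inv\<^bsub>G\<^esub> brace_star G H d b"
proof -
  let ?x = "lam a b" and ?b' = "inv\<^bsub>H\<^esub> b"
  have d: "d \<in> carrier G"
    using a b by (simp add: d_def)
  have "lam ?x ?b' = lam ?x (lam a (lam (inv\<^bsub>H\<^esub> a) ?b'))"
    using a b by (simp add: lam_lam_inv)
  also have "\<dots> = lam a (lam b (lam (inv\<^bsub>H\<^esub> a) ?b'))"
    using a b by (simp add: lam_lam_conjugate)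
  also have "\<dots> = lam a (lam b (lam (inv\<^bsub>H\<^esub> a) (lam ?b' (inv\<^bsub>G\<^esub> b))))"
    using b by (simp flip: mult_inv_eq_lam)
  also have "\<dots> = lam d (inv\<^bsub>G\<^esub> b)"
    using a b by (simp add: d_def lam_mult)
  finally have "?x \<otimes>\<^bsub>H\<^esub> ?b' = ?x \<otimes>\<^bsub>G\<^esub> inv\<^bsub>G\<^esub> lam d b"
    using a b d by (simp add: mult_eq_add_lam lam_inv)
  also have "\<dots> = (?x \<otimes>\<^bsub>G\<^esub> inv\<^bsub>G\<^esub> b) \<otimes>\<^bsub>G\<^esub> inv\<^bsub>G\<^esub> (lam d b \<otimes>\<^bsub>G\<^esub> inv\<^bsub>G\<^esub> b)"
    using a b d by (simp add: add.inv_mult_group add.m_assoc add.inv_solve_left)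
  finally show ?thesis
    by (simp add: brace_star_eq_lam)
qed

lemma swap_brace_star_set_subset:
  assumes subG: "subgroup B G" and subH: "subgroup B H"
  shows "brace_star_set H G B B \<subseteq> brace_star_set G H B B"
proof -
  note S = brace_star_set_add_subgroup[OF subG subH]
  note carr = subgroup.mem_carrier[OF subG]
  have "brace_star H G a b \<in> brace_star_set G H B B" if ab: "a \<in> B" "b \<in> B" for a b
  proof -
    let ?a = "inv\<^bsub>H\<^esub> a"
    let ?d = "?a \<otimes>\<^bsub>H\<^esub> b \<otimes>\<^bsub>H\<^esub> inv\<^bsub>H\<^esub> ?a \<otimes>\<^bsub>H\<^esub> inv\<^bsub>H\<^esub> b"
    have B: "?a \<in> B" "?d \<in> B"
      using ab by (simp_all add: subH subgroup.m_closed subgroup.m_inv_closed)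
    have "brace_star H G a b = lam ?a b \<otimes>\<^bsub>H\<^esub> inv\<^bsub>H\<^esub> b"
      using ab carr by (simp add: swap.brace_star_eq_lam swap_lam_eq)
    also have "\<dots> = brace_star G H ?a b \<otimes>\<^bsub>G\<^esub> inv\<^bsub>G\<^esub> brace_star G H ?d b"
      using ab B carr by (intro lam_mult_inv_eq_stars) auto
    also have "\<dots> \<in> brace_star_set G H B B"
      using ab B brace_star_in_brace_star_set[OF subG subH]
      by (intro subgroup.m_closed[OF S] subgroup.m_inv_closed[OF S]) auto
    finally show ?thesis .
  qed
  then have "generate H {brace_star H G x y | x y. x \<in> B \<and> y \<in> B} \<subseteq> brace_star_set G H B B"
    by (intro mult.generate_subgroup_incl brace_star_set_mult_subgroup[OF subG subH]) blast
  then show ?thesis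
    by (simp add: brace_star_set_def)
qed

lemma brace_star_set_swap_eq:
  assumes "subgroup B G" "subgroup B H"
  shows "brace_star_set H G B B = brace_star_set G H B B"
  using swap_brace_star_set_subset[OF assms]
    bi_skew_brace.swap_brace_star_set_subset[OF bi_skew_brace_swap assms(2,1)]
  by (rule equalityI)

text \<open>
  Being a subgroup for both operations has to be carried along in the induction, since it is what
  makes the two star sets of a term equal.
\<close>

lemma brace_derived_swap:
  "brace_derived H G k = brace_derived G H k \<and>
   subgroup (brace_derived G H k) G \<and> subgroup (brace_derived G H k) H"
proof (induction k)
  case 0
  show ?case
    using add.subgroup_self mult.subgroup_self by (simp add: carrier_eq)
next
  case (Suc k)
  then show ?case
    by (simp add: brace_star_set_swap_eq brace_star_set_add_subgroup
        brace_star_set_mult_subgroup)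
qed

end

theorem proposition3p3:
  fixes G :: "('a, 'b) monoid_scheme" and H :: "('a, 'c) monoid_scheme" and n :: nat
  assumes "bi_skew_brace G H"
  shows "soluble_of_class G H n \<longleftrightarrow> soluble_of_class H G n"
proof -
  interpret bi_skew_brace G H
    by (fact assms)
  show ?thesis
    by (simp add: soluble_of_class_def brace_soluble_def solubility_class_def
        brace_derived_swap one_eq)
qed

end
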